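(* Let $W_{(\alpha,\beta)}\equiv(T_1,T_2)$ be a (commuting) $2$-variable weighted shift on $\ell^2(\mathbb{Z}_+^2)$, with toral Aluthge transform $\widetilde W_{(\alpha,\beta)}=(\widetilde T_1,\widetilde T_2)$ and spherical Aluthge transform $\widehat W_{(\alpha,\beta)}=(\widehat T_1,\widehat T_2)$. Then: (i)(a) $\widetilde W_{(\alpha,\beta)}$ is a commuting pair if and only if $$\alpha_{(k_1,k_2+1)}\,\alpha_{(k_1+1,k_2+1)}=\alpha_{(k_1+1,k_2)}\,\alpha_{(k_1,k_2+2)}\quad\text{for all }k_1,k_2\ge 0,$$ and likewise, with the roles of the two variables exchanged, if and only if $$\beta_{(k_1+1,k_2)}\,\beta_{(k_1+1,k_2+1)}=\beta_{(k_1,k_2+1)}\,\beta_{(k_1+2,k_2)}\quad\text{for all }k_1,k_2\ge 0.$$ (i)(b) $\widehat W_{(\alpha,\beta)}$ is always a commuting pair. (ii) If $T_1$ and $T_2$ are both hyponormal operators (i.e. $W_{(\alpha,\beta)}$ is a commuting pair of hyponormal operators), then $\widehat W_{(\alpha,\beta)}$ is also a commuting pair of hyponormal operators, i.e. $\widehat T_1$ and $\widehat T_2$ commute and are both hyponormal.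
   Context: $\mathbb{Z}_+=\{0,1,2,\dots\}$, $\varepsilon_1=(1,0)$, $\varepsilon_2=(0,1)$, and $\{e_{\mathbf k}\}_{\mathbf k\in\mathbb{Z}_+^2}$ is the canonical orthonormal basis of $\ell^2(\mathbb{Z}_+^2)$. Given bounded double-indexed families of positive numbers $\alpha=(\alpha_{\mathbf k})$, $\beta=(\beta_{\mathbf k})$, $\mathbf k\in\mathbb{Z}_+^2$, the $2$-variable weighted shift $W_{(\alpha,\beta)}\equiv(T_1,T_2)$ is the pair of bounded operators on $\ell^2(\mathbb{Z}_+^2)$ with $T_1e_{\mathbf k}=\alpha_{\mathbf k}e_{\mathbf k+\varepsilon_1}$ and $T_2e_{\mathbf k}=\beta_{\mathbf k}e_{\mathbf k+\varepsilon_2}$; it is assumed commuting, i.e. $\beta_{\mathbf k+\varepsilon_1}\alpha_{\mathbf k}=\alpha_{\mathbf k+\varepsilon_2}\beta_{\mathbf k}$ for all $\mathbf k$. Toral Aluthge transform: with polar decompositions $T_i=V_i|T_i|$ ($V_i$ a partial isometry, $|T_i|=\sqrt{T_i^*T_i}$, $\ker V_i=\ker T_i$), $\widetilde W_{(\alpha,\beta)}=(\widetilde T_1,\widetilde T_2):=(|T_1|^{1/2}V_1|T_1|^{1/2},|T_2|^{1/2}V_2|T_2|^{1/2})$. Spherical Aluthge transform: let $P:=\sqrt{T_1^*T_1+T_2^*T_2}$ and write $(T_1,T_2)=(U_1P,U_2P)$ with $\ker U_1\cap\ker U_2=\ker P$ (joint polar decomposition); then $\widehat W_{(\alpha,\beta)}=(\widehat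 T_1,\widehat T_2):=(\sqrt P\,U_1\sqrt P,\sqrt P\,U_2\sqrt P)$. A bounded operator $T$ is hyponormal if $T^*T-TT^*\ge 0$. *)

theory Defs
  imports "HOL-Analysis.Analysis"
begin

section \<open>The complex Hilbert space of square-summable families\<close>

definition square_summable :: "('a \<Rightarrow> complex) \<Rightarrow> bool" where
  "square_summable f \<longleftrightarrow> (\<lambda>i. (cmod (f i))\<^sup>2) summable_on UNIV"

lemma square_summable_scale:
  assumes "square_summable f"
  shows "square_summable (\<lambda>i. c * f i)"
  using assms unfolding square_summable_def
  by (simp add: norm_mult power_mult_distrib summable_on_cmult_right)

lemma square_summable_add:
  assumes "square_summable f" "square_summable g"
  shows "square_summable (\<lambda>i. f i + g i)"
  unfolding square_summable_def
proof (rule summable_on_comparison_test)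
  show "(\<lambda>i. 2 * (cmod (f i))\<^sup>2 + 2 * (cmod (g i))\<^sup>2) summable_on UNIV"
    using assms unfolding square_summable_def
    by (intro summable_on_add summable_on_cmult_right)
  show "(cmod (f i + g i))\<^sup>2 \<le> 2 * (cmod (f i))\<^sup>2 + 2 * (cmod (g i))\<^sup>2" for i
  proof -
    have "(cmod (f i + g i))\<^sup>2 \<le> (cmod (f i) + cmod (g i))\<^sup>2"
      by (intro power_mono norm_triangle_ineq) simp
    also have "\<dots> \<le> 2 * (cmod (f i))\<^sup>2 + 2 * (cmod (g i))\<^sup>2"
      using sum_squares_bound[of "cmod (f i)" "cmod (g i)"] by (simp add: power2_sum)
    finally show ?thesis .
  qed
qed simp

lemma square_summable_mult:
  assumes "square_summable f" "square_summable g"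
  shows "(\<lambda>i. f i * cnj (g i)) summable_on UNIV"
proof (rule abs_summable_summable, rule summable_on_comparison_test)
  show "(\<lambda>i. (cmod (f i))\<^sup>2 + (cmod (g i))\<^sup>2) summable_on UNIV"
    using assms unfolding square_summable_def by (rule summable_on_add)
  show "norm (f i * cnj (g i)) \<le> (cmod (f i))\<^sup>2 + (cmod (g i))\<^sup>2" for i
  proof -
    have "2 * (cmod (f i) * cmod (g i)) \<le> (cmod (f i))\<^sup>2 + (cmod (g i))\<^sup>2"
      using sum_squares_bound[of "cmod (f i)" "cmod (g i)"] by simp
    moreover have "0 \<le> cmod (f i) * cmod (g i)" by simp
    ultimately show ?thesis unfolding norm_mult complex_mod_cnj by linarith
  qed
qed simp

typedef 'a ell2 = "{f :: 'a \<Rightarrow> complex. square_summable f}"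
  morphisms coord Abs_ell2
  by (rule exI[of _ "\<lambda>_. 0"]) (simp add: square_summable_def)

setup_lifting type_definition_ell2

lemma square_summable_coord: "square_summable (coord x)"
  using coord[of x] by simp

lemma ell2_eqI: "(\<And>i. coord x i = coord y i) \<Longrightarrow> x = y"
  by (simp add: coord_inject[symmetric] fun_eq_iff)

lift_definition scaleC :: "complex \<Rightarrow> 'a ell2 \<Rightarrow> 'a ell2" (infixr "*\<^sub>C" 75)
  is "\<lambda>c f i. c * f i"
  by (rule square_summable_scale)

text \<open>The inner product is linear in the first argument.\<close>

definition cinner :: "'a ell2 \<Rightarrow> 'a ell2 \<Rightarrow> complex" where
  "cinner x y = (\<Sum>\<^sub>\<infinity>i. coord x i * cnj (coord y i))"

text \<open>The underlying real inner product space structure, which provides the norm.\<close>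

instantiation ell2 :: (type) real_inner
begin

lift_definition zero_ell2 :: "'a ell2" is "\<lambda>_. 0"
  by (simp add: square_summable_def)

lift_definition plus_ell2 :: "'a ell2 \<Rightarrow> 'a ell2 \<Rightarrow> 'a ell2" is "\<lambda>f g i. f i + g i"
  by (rule square_summable_add)

lift_definition uminus_ell2 :: "'a ell2 \<Rightarrow> 'a ell2" is "\<lambda>f i. - f i"
  by (simp add: square_summable_def)

lift_definition minus_ell2 :: "'a ell2 \<Rightarrow> 'a ell2 \<Rightarrow> 'a ell2" is "\<lambda>f g i. f i - g i"
  subgoal for f g
    using square_summable_add[of f "\<lambda>i. - g i"] by (simp add: square_summable_def)
  done

lift_definition scaleR_ell2 :: "real \<Rightarrow> 'a ell2 \<Rightarrow> 'a ell2" is "\<lambda>r f i. r *\<^sub>R f i"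
  unfolding scaleR_conv_of_real by (rule square_summable_scale)

definition inner_ell2 :: "'a ell2 \<Rightarrow> 'a ell2 \<Rightarrow> real" where
  "inner_ell2 x y = Re (cinner x y)"

definition norm_ell2 :: "'a ell2 \<Rightarrow> real" where
  "norm_ell2 x = sqrt (\<Sum>\<^sub>\<infinity>i. (cmod (coord x i))\<^sup>2)"

definition dist_ell2 :: "'a ell2 \<Rightarrow> 'a ell2 \<Rightarrow> real" where
  "dist_ell2 x y = norm (x - y)"

definition sgn_ell2 :: "'a ell2 \<Rightarrow> 'a ell2" where
  "sgn_ell2 x = inverse (norm x) *\<^sub>R x"

definition uniformity_ell2 :: "('a ell2 \<times> 'a ell2) filter" where
  "uniformity_ell2 = (INF e\<in>{0<..}. principal {(x, y). dist x y < e})"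

definition open_ell2 :: "'a ell2 set \<Rightarrow> bool" where
  "open_ell2 U \<longleftrightarrow> (\<forall>x\<in>U. \<forall>\<^sub>F (x', y) in uniformity. x' = x \<longrightarrow> y \<in> U)"

instance
proof
  fix x y z :: "'a ell2" and r s :: real
  have prod: "(\<lambda>i. coord x i * cnj (coord y i)) summable_on UNIV" for x y :: "'a ell2"
    by (intro square_summable_mult square_summable_coord)
  have sq: "inner x x = (\<Sum>\<^sub>\<infinity>i. (cmod (coord x i))\<^sup>2)" for x :: "'a ell2"
    unfolding inner_ell2_def cinner_def using prod[of x x]
    by (simp add: infsum_Re[symmetric] complex_norm_square[symmetric] del: of_real_power)
  show "x + y + z = x + (y + z)" by transfer (simp add: add.assoc)
  show "x + y = y + x" by transfer (simp add: add.commute)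
  show "0 + x = x" by transfer simp
  show "- x + x = 0" by transfer simp
  show "x - y = x + - y" by transfer simp
  show "r *\<^sub>R (x + y) = r *\<^sub>R x + r *\<^sub>R y" by transfer (simp add: scaleR_add_right)
  show "(r + s) *\<^sub>R x = r *\<^sub>R x + s *\<^sub>R x" by transfer (simp add: scaleR_add_left)
  show "r *\<^sub>R s *\<^sub>R x = (r * s) *\<^sub>R x" by transfer simp
  show "1 *\<^sub>R x = x" by transfer simp
  show "dist x y = norm (x - y)" by (rule dist_ell2_def)
  show "sgn x = inverse (norm x) *\<^sub>R x" by (rule sgn_ell2_def)
  show "uniformity = (INF e\<in>{0<..}. principal {(x, y :: 'a ell2). dist x y < e})"
    by (rule uniformity_ell2_def)
  show "open U \<longleftrightarrow> (\<forall>x\<in>U. \<forall>\<^sub>F (x', y) in uniformity. x' = x \<longrightarrow> y \<in> U)" for U :: "'a ell2 set"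
    by (rule open_ell2_def)
  have "cinner x y = cnj (cinner y x)"
    unfolding cinner_def infsum_cnj[symmetric] by (simp add: mult.commute)
  thus "inner x y = inner y x" by (simp add: inner_ell2_def)
  show "inner (x + y) z = inner x z + inner y z"
    unfolding inner_ell2_def cinner_def plus_ell2.rep_eq distrib_right
    by (subst infsum_add) (auto intro: prod)
  show "inner (r *\<^sub>R x) y = r * inner x y"
    unfolding inner_ell2_def cinner_def scaleR_ell2.rep_eq scaleR_conv_of_real mult.assoc
    by (simp add: infsum_cmult_right')
  show "0 \<le> inner x x" unfolding sq by (simp add: infsum_nonneg)
  show "inner x x = 0 \<longleftrightarrow> x = 0"
  proof
    assume "inner x x = 0"
    hence le: "(\<Sum>\<^sub>\<infinity>i. (cmod (coord x i))\<^sup>2) \<le> 0" by (simp add: sq)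
    have "(cmod (coord x i))\<^sup>2 = 0" for i
      by (rule nonneg_infsum_le_0D[OF le])
        (use square_summable_coord[of x] in \<open>auto simp: square_summable_def\<close>)
    thus "x = 0" by (intro ell2_eqI) (simp add: zero_ell2.rep_eq)
  next
    assume "x = 0"
    thus "inner x x = 0" by (simp add: sq zero_ell2.rep_eq)
  qed
  show "norm x = sqrt (inner x x)" by (simp add: norm_ell2_def sq)
qed

end

lift_definition ket :: "'a \<Rightarrow> 'a ell2" is "\<lambda>k i. if i = k then 1 else 0"
  subgoal for k
    unfolding square_summable_def
    by (rule finite_nonzero_values_imp_summable_on) (rule finite_subset[of _ "{k}"], auto)
  done


section \<open>Operators\<close>

definition bounded_op :: "('a ell2 \<Rightarrow> 'a ell2) \<Rightarrow> bool" where
  "bounded_op T \<longleftrightarrow> bounded_linear T \<and> (\<forall>c x. T (c *\<^sub>C x) = c *\<^sub>C T x)"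

definition kernel :: "('a ell2 \<Rightarrow> 'a ell2) \<Rightarrow> 'a ell2 set" where
  "kernel T = {x. T x = 0}"

definition adj :: "('a ell2 \<Rightarrow> 'a ell2) \<Rightarrow> 'a ell2 \<Rightarrow> 'a ell2" where
  "adj T = (THE S. bounded_op S \<and> (\<forall>x y. cinner (T x) y = cinner x (S y)))"

definition positive_op :: "('a ell2 \<Rightarrow> 'a ell2) \<Rightarrow> bool" where
  "positive_op A \<longleftrightarrow> bounded_op A \<and> (\<forall>x. cinner (A x) x \<in> \<real>\<^sub>\<ge>\<^sub>0)"

definition sqrt_op :: "('a ell2 \<Rightarrow> 'a ell2) \<Rightarrow> 'a ell2 \<Rightarrow> 'a ell2" where
  "sqrt_op A = (THE R. positive_op R \<and> R \<circ> R = A)"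

definition abs_op :: "('a ell2 \<Rightarrow> 'a ell2) \<Rightarrow> 'a ell2 \<Rightarrow> 'a ell2" where
  "abs_op T = sqrt_op (adj T \<circ> T)"

definition partial_isometry :: "('a ell2 \<Rightarrow> 'a ell2) \<Rightarrow> bool" where
  "partial_isometry V \<longleftrightarrow> bounded_op V \<and>
     (\<forall>x. (\<forall>y\<in>kernel V. cinner x y = 0) \<longrightarrow> norm (V x) = norm x)"

definition polar_part :: "('a ell2 \<Rightarrow> 'a ell2) \<Rightarrow> 'a ell2 \<Rightarrow> 'a ell2" where
  "polar_part T = (THE V. partial_isometry V \<and> kernel V = kernel T \<and> T = V \<circ> abs_op T)"

definition hyponormal :: "('a ell2 \<Rightarrow> 'a ell2) \<Rightarrow> bool" where
  "hyponormal T \<longleftrightarrow> bounded_op T \<and> positive_op (\<lambda>x. adj T (T x) - T (adj T x))"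

type_synonym 'a op_pair = "('a ell2 \<Rightarrow> 'a ell2) \<times> ('a ell2 \<Rightarrow> 'a ell2)"

definition commuting_pair :: "'a op_pair \<Rightarrow> bool" where
  "commuting_pair W \<longleftrightarrow> fst W \<circ> snd W = snd W \<circ> fst W"


section \<open>Aluthge transforms\<close>

definition aluthge :: "('a ell2 \<Rightarrow> 'a ell2) \<Rightarrow> 'a ell2 \<Rightarrow> 'a ell2" where
  "aluthge T = sqrt_op (abs_op T) \<circ> polar_part T \<circ> sqrt_op (abs_op T)"

definition toral_aluthge :: "'a op_pair \<Rightarrow> 'a op_pair" where
  "toral_aluthge W = (aluthge (fst W), aluthge (snd W))"

definition joint_abs :: "'a op_pair \<Rightarrow> 'a ell2 \<Rightarrow> 'a ell2" where
  "joint_abs W = sqrt_op (\<lambda>x. adj (fst W) (fst W x) + adj (snd W) (snd W x))"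

definition joint_polar_part :: "'a op_pair \<Rightarrow> 'a op_pair" where
  "joint_polar_part W = (THE U. bounded_op (fst U) \<and> bounded_op (snd U) \<and>
     fst W = fst U \<circ> joint_abs W \<and> snd W = snd U \<circ> joint_abs W \<and>
     kernel (fst U) \<inter> kernel (snd U) = kernel (joint_abs W))"

definition spherical_aluthge :: "'a op_pair \<Rightarrow> 'a op_pair" where
  "spherical_aluthge W =
     (sqrt_op (joint_abs W) \<circ> fst (joint_polar_part W) \<circ> sqrt_op (joint_abs W),
      sqrt_op (joint_abs W) \<circ> snd (joint_polar_part W) \<circ> sqrt_op (joint_abs W))"


section \<open>Commuting 2-variable weighted shifts\<close>

text \<open>A bounded operator is determined by its values on the canonical basis, so for given weights
  at most one pair of operators satisfies the last four conditions.\<close>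

definition commuting_weighted_shift ::
  "(nat \<times> nat \<Rightarrow> real) \<Rightarrow> (nat \<times> nat \<Rightarrow> real) \<Rightarrow> (nat \<times> nat) op_pair \<Rightarrow> bool" where
  "commuting_weighted_shift \<alpha> \<beta> W \<longleftrightarrow>
     bounded (range \<alpha>) \<and> bounded (range \<beta>) \<and>
     (\<forall>k. 0 < \<alpha> k) \<and> (\<forall>k. 0 < \<beta> k) \<and>
     (\<forall>k. \<beta> (k + (1, 0)) * \<alpha> k = \<alpha> (k + (0, 1)) * \<beta> k) \<and>
     bounded_op (fst W) \<and> bounded_op (snd W) \<and>
     (\<forall>k. fst W (ket k) = \<alpha> k *\<^sub>R ket (k + (1, 0))) \<and>
     (\<forall>k. snd W (ket k) = \<beta> k *\<^sub>R ket (k + (0, 1)))"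

end

theory Submission
  imports Defs
begin

text \<open>
  Every operator involved maps \<open>ket k\<close> to \<open>w k *\<^sub>R ket (f k)\<close> for an injection \<open>f\<close> and bounded
  real weights \<open>w\<close>, with \<open>f = id\<close> for the moduli, and a bounded operator is determined by its values
  on the basis. Hence both transforms can be computed on weights: the toral one has weights
  \<open>sqrt (\<alpha> (k + \<epsilon>\<^sub>1) * \<alpha> k)\<close> and the spherical one \<open>\<alpha> k * sqrt (p (k + \<epsilon>\<^sub>1) / p k)\<close> with
  \<open>p = sqrt (\<alpha>\<^sup>2 + \<beta>\<^sup>2)\<close>. Commutativity becomes an identity between weights, hyponormality
  becomes monotonicity of the weights along \<open>f\<close>, and the latter passes to the spherical transform
  by the Cauchy-Schwarz inequality in the plane.
\<close>

section \<open>Basis vectors and bounded operators\<close>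

lemma coord_ket: "coord (ket k) i = (if i = k then 1 else 0)"
  by (simp add: ket.rep_eq)

lemma summable_norm_coord: "(\<lambda>i. (cmod (coord x i))\<^sup>2) summable_on UNIV"
  using square_summable_coord[of x] by (simp add: square_summable_def)

lemma norm_ell2_power2: "(norm x)\<^sup>2 = (\<Sum>\<^sub>\<infinity>i. (cmod (coord x i))\<^sup>2)"
  by (simp add: norm_ell2_def infsum_nonneg)

text \<open>No summability is assumed: the real family and its complex image are summable together,
  and otherwise both sums take the default value 0.\<close>

lemma infsum_complex_of_real:
  "(\<Sum>\<^sub>\<infinity>i\<in>A. complex_of_real (f i)) = complex_of_real (\<Sum>\<^sub>\<infinity>i\<in>A. f i)"
proof (rule infsum_bounded_linear_strong[OF _ bounded_linear_of_real])
  show "(\<lambda>i. complex_of_real (f i)) summable_on A \<longleftrightarrow> f summable_on A"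
  proof
    assume "(\<lambda>i. complex_of_real (f i)) summable_on A"
    from summable_on_Re[OF this] show "f summable_on A" by (simp only: Re_complex_of_real)
  qed (rule summable_on_of_real)
qed

lemma cinner_self: "cinner x x = complex_of_real ((norm x)\<^sup>2)"
  unfolding cinner_def norm_ell2_power2
  by (simp add: infsum_complex_of_real[symmetric] complex_norm_square[symmetric] del: of_real_power)

lemma cinner_ket_left: "cinner (ket k) y = cnj (coord y k)"
proof -
  have "cinner (ket k) y = (\<Sum>\<^sub>\<infinity>i\<in>{k}. coord (ket k) i * cnj (coord y i))"
    unfolding cinner_def by (rule infsum_cong_neutral) (auto simp: coord_ket)
  thus ?thesis by (simp add: coord_ket)
qed

lemma cinner_scaleR_left: "cinner (r *\<^sub>R x) y = complex_of_real r * cinner x y"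
  unfolding cinner_def
  by (simp add: scaleR_ell2.rep_eq scaleR_conv_of_real mult.assoc infsum_cmult_right')

lemma coord_sum: "coord (\<Sum>k\<in>F. g k) i = (\<Sum>k\<in>F. coord (g k) i)"
  by (induction F rule: infinite_finite_induct) (auto simp: zero_ell2.rep_eq plus_ell2.rep_eq)

text \<open>The squared distance from \<open>x\<close> to a finite partial expansion is the tail of
  the convergent series for the squared norm, so it tends to 0.\<close>

lemma tendsto_ket_expansion:
  "((\<lambda>F. \<Sum>k\<in>F. coord x k *\<^sub>C ket k) \<longlongrightarrow> x) (finite_subsets_at_top UNIV)"
proof -
  define s where "s = (\<Sum>\<^sub>\<infinity>i. (cmod (coord x i))\<^sup>2)"
  have lim: "((\<lambda>F. \<Sum>i\<in>F. (cmod (coord x i))\<^sup>2) \<longlongrightarrow> s) (finite_subsets_at_top UNIV)"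
    unfolding s_def using has_sum_infsum[OF summable_norm_coord] by (simp add: has_sum_def)
  have eq: "norm (x - (\<Sum>k\<in>F. coord x k *\<^sub>C ket k)) = sqrt (s - (\<Sum>i\<in>F. (cmod (coord x i))\<^sup>2))"
    if "finite F" for F
  proof -
    have c: "coord (x - (\<Sum>k\<in>F. coord x k *\<^sub>C ket k)) i = (if i \<in> F then 0 else coord x i)" for i
      using that by (simp add: minus_ell2.rep_eq coord_sum scaleC.rep_eq coord_ket
          if_distrib[of "\<lambda>z. _ * z"] cong: if_cong)
    have "(\<Sum>\<^sub>\<infinity>i. (cmod (if i \<in> F then 0 else coord x i))\<^sup>2)
        = (\<Sum>\<^sub>\<infinity>i\<in>UNIV - F. (cmod (coord x i))\<^sup>2)"
      by (rule infsum_cong_neutral) auto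
    also have "\<dots> = s - (\<Sum>i\<in>F. (cmod (coord x i))\<^sup>2)"
      unfolding s_def using that
      by (subst infsum_Diff) (auto intro: summable_norm_coord summable_on_finite)
    finally show ?thesis by (simp add: norm_ell2_def c)
  qed
  have "((\<lambda>F. sqrt (s - (\<Sum>i\<in>F. (cmod (coord x i))\<^sup>2))) \<longlongrightarrow> sqrt (s - s))
          (finite_subsets_at_top UNIV)"
    by (intro tendsto_intros lim)
  hence "((\<lambda>F. norm (x - (\<Sum>k\<in>F. coord x k *\<^sub>C ket k))) \<longlongrightarrow> 0) (finite_subsets_at_top UNIV)"
    by (subst filterlim_cong[OF refl refl eventually_finite_subsets_at_top_weakI[OF eq]]) auto
  hence "((\<lambda>F. dist (\<Sum>k\<in>F. coord x k *\<^sub>C ket k) x) \<longlongrightarrow> 0) (finite_subsets_at_top UNIV)"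
    by (simp add: dist_norm norm_minus_commute)
  thus ?thesis by (rule tendsto_dist_iff[THEN iffD2])
qed

lemma bounded_op_scaleR: "bounded_op T \<Longrightarrow> T (r *\<^sub>R x) = r *\<^sub>R T x"
  by (simp add: bounded_op_def linear_simps)

lemma bounded_op_diff: "bounded_op T \<Longrightarrow> T (x - y) = T x - T y"
  by (simp add: bounded_op_def linear_simps)

lemma bounded_op_zero: "bounded_op T \<Longrightarrow> T 0 = 0"
  by (simp add: bounded_op_def linear_simps)

lemma bounded_op_comp: "bounded_op S \<Longrightarrow> bounded_op T \<Longrightarrow> bounded_op (S \<circ> T)"
  unfolding bounded_op_def comp_def by (auto intro: bounded_linear_compose)

text \<open>Linearity gives agreement on finite expansions and continuity passes it to their norm
  limit. This is what reduces all later operator identities to basis vectors.\<close>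

lemma bounded_op_eqI:
  fixes S T :: "'a ell2 \<Rightarrow> 'a ell2"
  assumes S: "bounded_op S" and T: "bounded_op T" and "\<And>k. S (ket k) = T (ket k)"
  shows "S = T"
proof
  fix x
  let ?F = "finite_subsets_at_top UNIV"
  have lim: "((\<lambda>F. \<Sum>k\<in>F. coord x k *\<^sub>C U (ket k)) \<longlongrightarrow> U x) ?F"
    if U: "bounded_op U" for U :: "'a ell2 \<Rightarrow> 'a ell2"
  proof -
    have "U (\<Sum>k\<in>F. coord x k *\<^sub>C ket k) = (\<Sum>k\<in>F. coord x k *\<^sub>C U (ket k))" for F
      using U by (simp add: bounded_op_def linear_sum bounded_linear.linear)
    thus ?thesis
      using bounded_linear.tendsto[OF _ tendsto_ket_expansion, of U x] U
      by (simp add: bounded_op_def)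
  qed
  show "S x = T x"
    using lim[OF S] lim[OF T] assms(3) by (auto intro: tendsto_unique[rotated])
qed

text \<open>Since \<open>adj\<close> is a definite description, uniqueness is part of the goal;
  pairing with \<open>ket k\<close> reads off the coordinates of any competitor.\<close>

lemma adj_eqI:
  assumes "bounded_op S" "\<And>x y. cinner (T x) y = cinner x (S y)"
  shows "adj T = S"
  unfolding adj_def
proof (rule the_equality)
  show "bounded_op S \<and> (\<forall>x y. cinner (T x) y = cinner x (S y))" using assms by simp
  fix R assume R: "bounded_op R \<and> (\<forall>x y. cinner (T x) y = cinner x (R y))"
  show "R = S"
  proof (intro ext ell2_eqI)
    fix y k
    have "cinner (ket k) (R y) = cinner (ket k) (S y)" using R assms by metis
    thus "coord (R y) k = coord (S y) k" by (simp add: cinner_ket_left)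
  qed
qed

section \<open>Weighted shifts along an injection\<close>

text \<open>A weighted composition operator, covering both directions of a shift along
  \<open>f\<close>: the backward shift with \<open>g = f\<close>, and the forward shift with
  \<open>g = inv f\<close>. The use of \<open>Abs_ell2\<close> is meaningful once the family is
  known to be square summable.\<close>

definition wcomp :: "('a \<Rightarrow> 'a) \<Rightarrow> ('a \<Rightarrow> real) \<Rightarrow> 'a ell2 \<Rightarrow> 'a ell2" where
  "wcomp g w x = Abs_ell2 (\<lambda>j. of_real (w j) * coord x (g j))"

text \<open>Reindexing along \<open>g\<close> bounds the sum by a part of the squared norm of
  \<open>x\<close>. Injectivity is asked only on the support of \<open>w\<close>, so that
  \<open>inv f\<close>, arbitrary outside the range of \<open>f\<close>, is an admissible
  \<open>g\<close>.\<close>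

lemma wcomp_weighted_sum:
  assumes w: "\<And>j. \<bar>w j\<bar> \<le> B" and g: "inj_on g {j. w j \<noteq> 0}"
  shows "(\<lambda>j. (cmod (of_real (w j) * coord x (g j)))\<^sup>2) summable_on UNIV" (is "?f summable_on _")
    and "(\<Sum>\<^sub>\<infinity>j. (cmod (of_real (w j) * coord x (g j)))\<^sup>2) \<le> B\<^sup>2 * (norm x)\<^sup>2"
proof -
  let ?A = "{j. w j \<noteq> 0}"
  let ?h = "\<lambda>i. (cmod (coord x i))\<^sup>2"
  have hA: "?h summable_on g ` ?A"
    using summable_norm_coord by (rule summable_on_subset_banach) simp
  hence hg: "(\<lambda>j. B\<^sup>2 * ?h (g j)) summable_on ?A"
    by (intro summable_on_cmult_right) (simp add: summable_on_reindex[OF g] comp_def)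
  have le: "?f j \<le> B\<^sup>2 * ?h (g j)" for j
    using power_mono[OF w[of j], of 2]
    by (auto simp: norm_mult power_mult_distrib intro!: mult_right_mono)
  have fA: "?f summable_on ?A"
    by (rule summable_on_comparison_test[OF hg]) (auto intro: le)
  show "?f summable_on UNIV"
    using fA by (rule summable_on_cong_neutral[THEN iffD1, rotated -1]) auto
  have "infsum ?f UNIV = infsum ?f ?A"
    by (rule infsum_cong_neutral) auto
  also have "\<dots> \<le> (\<Sum>\<^sub>\<infinity>j\<in>?A. B\<^sup>2 * ?h (g j))"
    by (rule infsum_mono[OF fA hg le])
  also have "\<dots> = B\<^sup>2 * infsum ?h (g ` ?A)"
    by (simp add: infsum_cmult_right' infsum_reindex[OF g] comp_def)
  also have "\<dots> \<le> B\<^sup>2 * infsum ?h UNIV"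
    by (intro mult_left_mono infsum_mono_neutral hA summable_norm_coord) auto
  finally show "infsum ?f UNIV \<le> B\<^sup>2 * (norm x)\<^sup>2" by (simp add: norm_ell2_power2)
qed

lemma bounded_range_realE:
  assumes "bounded (range w)" obtains B where "\<And>j. \<bar>w j :: real\<bar> \<le> B" "B \<ge> 0"
proof -
  obtain B where "\<And>j. \<bar>w j\<bar> \<le> B" using assms by (auto simp: bounded_iff)
  thus ?thesis using that abs_ge_zero order_trans by metis
qed

lemma coord_wcomp:
  assumes "bounded (range w)" "inj_on g {j. w j \<noteq> 0}"
  shows "coord (wcomp g w x) j = of_real (w j) * coord x (g j)"
proof -
  obtain B where "\<And>j. \<bar>w j\<bar> \<le> B" using bounded_range_realE[OF assms(1)] by blast
  from wcomp_weighted_sum(1)[OF this assms(2)]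
  show ?thesis unfolding wcomp_def by (subst Abs_ell2_inverse) (auto simp: square_summable_def)
qed

lemma bounded_op_wcomp:
  assumes w: "bounded (range w)" and g: "inj_on g {j. w j \<noteq> 0}"
  shows "bounded_op (wcomp g w)"
proof -
  obtain B where B: "\<And>j. \<bar>w j\<bar> \<le> B" "B \<ge> 0" using bounded_range_realE[OF w] by blast
  note c = coord_wcomp[OF w g]
  have "bounded_linear (wcomp g w)"
  proof (rule bounded_linear_intro)
    show "wcomp g w (x + y) = wcomp g w x + wcomp g w y" for x y
      by (rule ell2_eqI) (simp add: c plus_ell2.rep_eq algebra_simps)
    show "wcomp g w (r *\<^sub>R x) = r *\<^sub>R wcomp g w x" for r x
      by (rule ell2_eqI) (simp add: c scaleR_ell2.rep_eq scaleR_conv_of_real algebra_simps)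
    show "norm (wcomp g w x) \<le> norm x * B" for x
    proof (rule power2_le_imp_le)
      show "(norm (wcomp g w x))\<^sup>2 \<le> (norm x * B)\<^sup>2"
        using wcomp_weighted_sum(2)[OF B(1) g, of x]
        by (simp add: norm_ell2_power2[of "wcomp g w x"] c power_mult_distrib mult.commute)
    qed (use B in simp)
  qed
  moreover have "wcomp g w (a *\<^sub>C x) = a *\<^sub>C wcomp g w x" for a x
    by (rule ell2_eqI) (simp add: c scaleC.rep_eq algebra_simps)
  ultimately show ?thesis by (simp add: bounded_op_def)
qed

text \<open>The forward shift sending \<open>ket k\<close> to
  \<open>w k *\<^sub>R ket (f k)\<close>. The zero weight outside the range of \<open>f\<close>
  suppresses the arbitrary values of \<open>inv f\<close>; with \<open>f = id\<close> this is a
  diagonal operator.\<close>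

definition wshift :: "('a \<Rightarrow> 'a) \<Rightarrow> ('a \<Rightarrow> real) \<Rightarrow> 'a ell2 \<Rightarrow> 'a ell2" where
  "wshift f w = wcomp (inv f) (\<lambda>j. if j \<in> range f then w (inv f j) else 0)"

context
  fixes f :: "'a \<Rightarrow> 'a" and w :: "'a \<Rightarrow> real"
  assumes f: "inj f" and w: "bounded (range w)"
begin

private lemma wshift_side_conditions:
  "bounded (range (\<lambda>j. if j \<in> range f then w (inv f j) else 0))"
  "inj_on (inv f) {j. (if j \<in> range f then w (inv f j) else 0) \<noteq> 0}"
proof -
  show "bounded (range (\<lambda>j. if j \<in> range f then w (inv f j) else 0))"
    by (rule bounded_subset[of "insert 0 (range w)"]) (use w in auto)
  show "inj_on (inv f) {j. (if j \<in> range f then w (inv f j) else 0) \<noteq> 0}"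
    by (rule inj_on_subset[of _ "range f"]) (auto intro: inj_on_inv_into split: if_splits)
qed

lemma bounded_op_wshift: "bounded_op (wshift f w)"
  unfolding wshift_def by (intro bounded_op_wcomp wshift_side_conditions)

lemma coord_wshift:
  "coord (wshift f w x) j = (if j \<in> range f then of_real (w (inv f j)) * coord x (inv f j) else 0)"
  unfolding wshift_def by (subst coord_wcomp[OF wshift_side_conditions]) simp

lemma coord_wshift_app: "coord (wshift f w x) (f k) = of_real (w k) * coord x k"
  by (simp add: coord_wshift f)

lemma wshift_ket: "wshift f w (ket k) = w k *\<^sub>R ket (f k)"
proof (rule ell2_eqI)
  fix j show "coord (wshift f w (ket k)) j = coord (w k *\<^sub>R ket (f k)) j"
    by (cases "j \<in> range f")
      (auto simp: coord_wshift coord_ket scaleR_ell2.rep_eq scaleR_conv_of_real f inj_eq)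
qed

lemma wshift_eqI:
  assumes "bounded_op T" "\<And>k. T (ket k) = w k *\<^sub>R ket (f k)"
  shows "T = wshift f w"
  by (rule bounded_op_eqI) (simp_all add: assms bounded_op_wshift wshift_ket)

lemma bounded_op_backward: "bounded_op (wcomp f w)"
  by (intro bounded_op_wcomp w inj_on_subset[OF f]) simp

lemma coord_backward: "coord (wcomp f w x) j = of_real (w j) * coord x (f j)"
  by (intro coord_wcomp w inj_on_subset[OF f]) simp

text \<open>The image of the forward shift is supported on the range of \<open>f\<close>, and
  reindexing the inner product along \<open>f\<close> moves the weights to the other
  argument.\<close>

lemma adj_wshift: "adj (wshift f w) = wcomp f w"
proof (rule adj_eqI[OF bounded_op_backward])
  fix x y
  have "cinner (wshift f w x) y
      = (\<Sum>\<^sub>\<infinity>j\<in>range f. coord (wshift f w x) j * cnj (coord y j))"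
    unfolding cinner_def by (rule infsum_cong_neutral) (auto simp: coord_wshift)
  also have "\<dots> = cinner x (wcomp f w y)"
    by (simp add: infsum_reindex[OF f] comp_def coord_wshift_app coord_backward cinner_def
        mult.assoc mult.left_commute)
  finally show "cinner (wshift f w x) y = cinner x (wcomp f w y)" .
qed

lemma kernel_wshift:
  assumes "\<And>k. w k \<noteq> 0"
  shows "kernel (wshift f w) = {0}"
proof -
  have "x = 0" if "wshift f w x = 0" for x
    using coord_wshift_app[of x] assms that by (intro ell2_eqI) (simp add: zero_ell2.rep_eq)
  thus ?thesis using bounded_op_zero[OF bounded_op_wshift] by (auto simp: kernel_def)
qed

end

section \<open>Diagonal operators, products and commutation of weighted shifts\<close>

lemma coord_diagonal:
  "bounded (range w) \<Longrightarrow> coord (wshift id w x) k = of_real (w k) * coord x k"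
  using coord_wshift_app[of id w x k] by simp

lemma wshift_inject:
  assumes "inj f" "bounded (range w)" "bounded (range v)"
  shows "wshift f w = wshift f v \<longleftrightarrow> w = v"
proof
  assume eq: "wshift f w = wshift f v"
  show "w = v"
  proof
    fix k
    have "coord (wshift f w (ket k)) (f k) = coord (wshift f v (ket k)) (f k)" by (simp add: eq)
    thus "w k = v k" by (simp add: coord_wshift_app assms coord_ket)
  qed
qed simp

lemma bounded_range_mult:
  assumes "bounded (range u)" "bounded (range v)"
  shows "bounded (range (\<lambda>k. u k * v k :: real))"
proof -
  obtain A B where "\<And>k. \<bar>u k\<bar> \<le> A" "\<And>k. \<bar>v k\<bar> \<le> B" "A \<ge> 0"
    using assms bounded_range_realE by metis
  hence "\<bar>u k * v k\<bar> \<le> A * B" for k unfolding abs_mult by (intro mult_mono) auto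
  thus ?thesis by (auto simp: bounded_iff)
qed

lemma bounded_range_sqrt:
  assumes "bounded (range u)"
  shows "bounded (range (\<lambda>k. sqrt (u k)))"
proof -
  obtain A where "\<And>k. \<bar>u k\<bar> \<le> A" using assms bounded_range_realE by metis
  \<comment> \<open>Negative values are covered because \<open>sqrt\<close> is an odd function on
    the reals, so that \<open>\<bar>sqrt x\<bar> = sqrt \<bar>x\<bar>\<close>.\<close>
  hence "\<bar>sqrt (u k)\<bar> \<le> sqrt A" for k by (metis real_sqrt_abs2 real_sqrt_le_iff real_sqrt_mult)
  thus ?thesis by (auto simp: bounded_iff)
qed

lemma bounded_range_comp: "bounded (range u) \<Longrightarrow> bounded (range (\<lambda>k. u (f k)))"
  by (rule bounded_subset) auto

lemma wshift_comp:
  assumes "inj f" "inj g" "bounded (range w)" "bounded (range v)"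
  shows "wshift f w \<circ> wshift g v = wshift (f \<circ> g) (\<lambda>k. w (g k) * v k)"
proof (rule wshift_eqI)
  show "bounded_op (wshift f w \<circ> wshift g v)"
    by (intro bounded_op_comp bounded_op_wshift assms)
  show "(wshift f w \<circ> wshift g v) (ket k) = (w (g k) * v k) *\<^sub>R ket ((f \<circ> g) k)" for k
    by (simp add: wshift_ket assms bounded_op_scaleR[OF bounded_op_wshift])
qed (intro assms inj_compose bounded_range_mult bounded_range_comp[OF assms(3), of g])+

lemma diagonal_wshift_diagonal:
  assumes "inj f" "bounded (range c)" "bounded (range w)" "bounded (range d)"
  shows "wshift id c \<circ> wshift f w \<circ> wshift id d = wshift f (\<lambda>k. c (f k) * w k * d k)"
proof -
  have "wshift id c \<circ> wshift f w = wshift f (\<lambda>k. c (f k) * w k)"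
    using wshift_comp[OF inj_on_id assms(1-3)] by simp
  thus ?thesis
    using wshift_comp[OF assms(1) inj_on_id
        bounded_range_mult[OF bounded_range_comp[OF assms(2), of f] assms(3)] assms(4)] by simp
qed

text \<open>Both products are shifts along the same injection \<open>f \<circ> g\<close>, so they
  agree exactly when their weights do.\<close>

lemma commuting_pair_wshift:
  assumes "inj f" "inj g" "f \<circ> g = g \<circ> f" "bounded (range a)" "bounded (range b)"
  shows "commuting_pair (wshift f a, wshift g b) \<longleftrightarrow> (\<forall>k. a (g k) * b k = b (f k) * a k)"
proof -
  have "commuting_pair (wshift f a, wshift g b) \<longleftrightarrow>
      wshift (f \<circ> g) (\<lambda>k. a (g k) * b k) = wshift (f \<circ> g) (\<lambda>k. b (f k) * a k)"
    by (simp add: commuting_pair_def wshift_comp assms)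
  also have "\<dots> \<longleftrightarrow> (\<forall>k. a (g k) * b k = b (f k) * a k)"
    by (subst wshift_inject)
      (auto simp: fun_eq_iff intro!: inj_compose bounded_range_mult assms
        bounded_range_comp[OF assms(4), of g] bounded_range_comp[OF assms(5), of f])
  finally show ?thesis .
qed

section \<open>Positivity and hyponormality in terms of weights\<close>

lemma positive_op_diagonal:
  assumes c: "bounded (range c)"
  shows "positive_op (wshift id c) \<longleftrightarrow> (\<forall>k. c k \<ge> 0)"
proof
  assume "positive_op (wshift id c)"
  hence "cinner (wshift id c (ket k)) (ket k) \<in> \<real>\<^sub>\<ge>\<^sub>0" for k by (simp add: positive_op_def)
  thus "\<forall>k. c k \<ge> 0"
    by (simp add: wshift_ket c cinner_scaleR_left cinner_ket_left coord_ket)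
next
  assume nonneg: "\<forall>k. c k \<ge> 0"
  have "cinner (wshift id c x) x \<in> \<real>\<^sub>\<ge>\<^sub>0" for x
  proof -
    have "cinner (wshift id c x) x = (\<Sum>\<^sub>\<infinity>k. complex_of_real (c k * (cmod (coord x k))\<^sup>2))"
      unfolding cinner_def
      by (simp add: coord_diagonal c mult.assoc complex_norm_square[symmetric] del: of_real_power)
    also have "\<dots> = complex_of_real (\<Sum>\<^sub>\<infinity>k. c k * (cmod (coord x k))\<^sup>2)"
      by (rule infsum_complex_of_real)
    finally show ?thesis using nonneg by (simp add: infsum_nonneg)
  qed
  thus "positive_op (wshift id c)" by (simp add: positive_op_def bounded_op_wshift c)
qed

text \<open>The self-commutator is diagonal with entries \<open>c\<close>. Outside the range of
  \<open>f\<close> the entry is a square, hence nonnegative; at \<open>f k\<close> it is the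
  difference of the two squares being compared.\<close>

lemma hyponormal_wshift:
  assumes f: "inj f" and w: "bounded (range w)"
  shows "hyponormal (wshift f w) \<longleftrightarrow> (\<forall>k. (w k)\<^sup>2 \<le> (w (f k))\<^sup>2)"
proof -
  define c where "c j = (w j)\<^sup>2 - (if j \<in> range f then (w (inv f j))\<^sup>2 else 0)" for j
  have c: "bounded (range c)"
  proof -
    obtain B where B: "\<And>j. \<bar>w j\<bar> \<le> B" "B \<ge> 0" using bounded_range_realE[OF w] by blast
    have "(w j)\<^sup>2 \<le> B\<^sup>2" for j using power_mono[OF B(1)[of j], of 2] by simp
    hence "\<bar>c j\<bar> \<le> B\<^sup>2 + B\<^sup>2" for j
      unfolding c_def by (smt (verit) zero_le_power2)
    thus ?thesis by (auto simp: bounded_iff)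
  qed
  have "(\<lambda>x. adj (wshift f w) (wshift f w x) - wshift f w (adj (wshift f w) x)) = wshift id c"
    unfolding adj_wshift[OF f w]
    by (intro ext ell2_eqI)
      (auto simp: minus_ell2.rep_eq coord_backward coord_wshift coord_diagonal[OF c] f w c_def
        power2_eq_square algebra_simps)
  hence "hyponormal (wshift f w) \<longleftrightarrow> (\<forall>j. c j \<ge> 0)"
    by (simp add: hyponormal_def bounded_op_wshift f w positive_op_diagonal c)
  also have "\<dots> \<longleftrightarrow> (\<forall>k. (w k)\<^sup>2 \<le> (w (f k))\<^sup>2)"
    using f by (auto simp: c_def dest: spec[of _ "f _"])
  finally show ?thesis .
qed

section \<open>Polar decompositions of weighted shifts\<close>

text \<open>For uniqueness, let \<open>R\<close> be a positive root and
  \<open>r = sqrt (a k)\<close>. Then \<open>R + r\<close> annihilates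
  \<open>(R - r) (ket k)\<close>, and it is injective because \<open>R\<close> is positive and
  \<open>r > 0\<close>; hence \<open>ket k\<close> is an eigenvector of \<open>R\<close> for
  \<open>r\<close>.\<close>

lemma sqrt_op_diagonal:
  assumes a: "bounded (range a)" "\<And>k. a k > 0"
  shows "sqrt_op (wshift id a) = wshift id (\<lambda>k. sqrt (a k))"
  unfolding sqrt_op_def
proof (rule the_equality)
  note s = bounded_range_sqrt[OF a(1)]
  have "wshift id (\<lambda>k. sqrt (a k)) \<circ> wshift id (\<lambda>k. sqrt (a k)) = wshift id a"
    using a(2) by (simp add: wshift_comp s less_imp_le)
  thus "positive_op (wshift id (\<lambda>k. sqrt (a k))) \<and>
      wshift id (\<lambda>k. sqrt (a k)) \<circ> wshift id (\<lambda>k. sqrt (a k)) = wshift id a"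
    using a(2) by (simp add: positive_op_diagonal s less_imp_le)
  fix R assume R: "positive_op R \<and> R \<circ> R = wshift id a"
  hence bR: "bounded_op R" by (simp add: positive_op_def)
  show "R = wshift id (\<lambda>k. sqrt (a k))"
  proof (rule wshift_eqI[OF inj_on_id s bR])
    fix k
    define r where "r = sqrt (a k)"
    have r: "r > 0" "r * r = a k" using a(2)[of k] by (simp_all add: r_def)
    define y where "y = R (ket k) - r *\<^sub>R ket k"
    have "R (R (ket k)) = a k *\<^sub>R ket k"
      using R by (metis comp_apply wshift_ket a(1) inj_on_id id_apply)
    \<comment> \<open>A negative eigenvalue of the positive operator \<open>R\<close>, unless \<open>y = 0\<close>.\<close>
    hence "R y = (- r) *\<^sub>R y"
      by (simp add: y_def bounded_op_diff bR bounded_op_scaleR scaleR_diff_right r)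
    moreover have "cinner (R y) y \<in> \<real>\<^sub>\<ge>\<^sub>0" using R by (simp add: positive_op_def)
    ultimately have "complex_of_real (- r * (norm y)\<^sup>2) \<in> \<real>\<^sub>\<ge>\<^sub>0"
      by (simp only: cinner_scaleR_left cinner_self of_real_mult)
    hence "- r * (norm y)\<^sup>2 \<ge> 0" by (simp only: nonneg_Reals_of_real_iff)
    hence "y = 0" using r(1) by (simp add: mult_le_0_iff)
    thus "R (ket k) = sqrt (a k) *\<^sub>R ket (id k)" by (simp add: y_def r_def)
  qed
qed

text \<open>Supplies uniqueness of both polar decompositions: where the modulus has a nonzero
  eigenvalue, the other factor is forced.\<close>

lemma diagonal_cancel_ket:
  assumes "bounded_op V" "T = V \<circ> wshift id d" "bounded (range d)" "d k \<noteq> 0"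
  shows "V (ket k) = inverse (d k) *\<^sub>R T (ket k)"
  using assms by (simp add: wshift_ket bounded_op_scaleR)

context
  fixes f :: "'a \<Rightarrow> 'a" and w :: "'a \<Rightarrow> real"
  assumes f: "inj f" and w: "bounded (range w)" and pos: "\<And>k. w k > 0"
begin

lemma abs_op_wshift: "abs_op (wshift f w) = wshift id w"
proof -
  have b: "bounded (range (\<lambda>k. w k * w k))" by (intro bounded_range_mult w)
  have "adj (wshift f w) \<circ> wshift f w = wshift id (\<lambda>k. w k * w k)"
    unfolding adj_wshift[OF f w]
    by (intro ext ell2_eqI) (simp add: coord_backward coord_wshift_app coord_diagonal f w b)
  thus ?thesis
    using pos by (simp add: abs_op_def sqrt_op_diagonal b less_imp_le)
qed

text \<open>Positive weights make the kernel zero, so the partial isometry is a genuine isometry: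
  the unweighted shift.\<close>

lemma polar_part_wshift: "polar_part (wshift f w) = wshift f (\<lambda>_. 1)"
  unfolding polar_part_def abs_op_wshift
proof (rule the_equality)
  have b: "bounded (range (\<lambda>_::'a. 1::real))" by simp
  have iso: "norm (wshift f (\<lambda>_. 1) x) = norm x" for x
  proof -
    have "(\<Sum>\<^sub>\<infinity>j. (cmod (coord (wshift f (\<lambda>_. 1) x) j))\<^sup>2)
        = (\<Sum>\<^sub>\<infinity>j\<in>range f. (cmod (coord (wshift f (\<lambda>_. 1) x) j))\<^sup>2)"
      by (rule infsum_cong_neutral) (auto simp: coord_wshift f b)
    also have "\<dots> = (\<Sum>\<^sub>\<infinity>k. (cmod (coord x k))\<^sup>2)"
      by (simp add: infsum_reindex[OF f] comp_def coord_wshift_app f b)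
    finally show ?thesis by (simp add: norm_ell2_def)
  qed
  have "kernel (wshift f (\<lambda>_. 1)) = kernel (wshift f w)"
    using pos by (simp add: kernel_wshift f w b less_imp_neq[symmetric])
  thus "partial_isometry (wshift f (\<lambda>_. 1)) \<and> kernel (wshift f (\<lambda>_. 1)) = kernel (wshift f w) \<and>
      wshift f w = wshift f (\<lambda>_. 1) \<circ> wshift id w"
    by (simp add: partial_isometry_def bounded_op_wshift f b iso wshift_comp w)
  fix V
  assume V: "partial_isometry V \<and> kernel V = kernel (wshift f w) \<and> wshift f w = V \<circ> wshift id w"
  hence bV: "bounded_op V" by (simp add: partial_isometry_def)
  show "V = wshift f (\<lambda>_. 1)"
  proof (rule wshift_eqI[OF f b bV])
    show "V (ket k) = 1 *\<^sub>R ket (f k)" for k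
    proof -
      have "V (ket k) = inverse (w k) *\<^sub>R wshift f w (ket k)"
        by (rule diagonal_cancel_ket) (use V bV w pos[of k] in \<open>simp_all del: comp_apply\<close>)
      thus ?thesis using pos[of k] by (simp add: wshift_ket f w)
    qed
  qed
qed

lemma aluthge_wshift:
  "aluthge (wshift f w) = wshift f (\<lambda>k. sqrt (w (f k)) * sqrt (w k))"
  unfolding aluthge_def abs_op_wshift polar_part_wshift sqrt_op_diagonal[OF w pos]
  by (simp add: wshift_comp f bounded_range_sqrt[OF w]
      bounded_range_comp[OF bounded_range_sqrt[OF w], of f])

end

section \<open>Joint polar decomposition and the weights of the spherical transform\<close>

context
  fixes f g :: "'a \<Rightarrow> 'a" and a b p :: "'a \<Rightarrow> real"
  assumes fg: "inj f" "inj g" and ab: "bounded (range a)" "bounded (range b)"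
    and pos: "\<And>k. a k > 0" "\<And>k. b k > 0"
  defines "p \<equiv> \<lambda>k. sqrt ((a k)\<^sup>2 + (b k)\<^sup>2)"
begin

private lemma p_pos: "p k > 0"
  using pos[of k] by (simp add: p_def add_pos_pos)

private lemma bounded_squares: "bounded (range (\<lambda>k. (a k)\<^sup>2 + (b k)\<^sup>2))"
  unfolding power2_eq_square by (intro bounded_plus_comp bounded_range_mult ab)

lemma bounded_range_joint_modulus: "bounded (range p)"
  unfolding p_def by (intro bounded_range_sqrt bounded_squares)

lemma bounded_range_normalized_weights:
  "bounded (range (\<lambda>k. a k / p k))" "bounded (range (\<lambda>k. b k / p k))"
proof -
  have "\<bar>a k / p k\<bar> \<le> 1" "\<bar>b k / p k\<bar> \<le> 1" for k
    using p_pos[of k] pos[of k] unfolding p_def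
    by (simp_all add: abs_of_pos divide_le_eq real_le_rsqrt)
  thus "bounded (range (\<lambda>k. a k / p k))" "bounded (range (\<lambda>k. b k / p k))"
    unfolding bounded_iff by auto
qed

lemma joint_abs_wshift: "joint_abs (wshift f a, wshift g b) = wshift id p"
proof -
  have "(\<lambda>x. adj (wshift f a) (wshift f a x) + adj (wshift g b) (wshift g b x))
      = wshift id (\<lambda>k. (a k)\<^sup>2 + (b k)\<^sup>2)"
    unfolding adj_wshift[OF fg(1) ab(1)] adj_wshift[OF fg(2) ab(2)]
    by (intro ext ell2_eqI)
      (simp add: plus_ell2.rep_eq coord_backward coord_wshift_app coord_diagonal fg ab
        bounded_squares distrib_left distrib_right power2_eq_square[of "complex_of_real _"])
  moreover have "(a k)\<^sup>2 + (b k)\<^sup>2 > 0" for k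
    using pos[of k] by (intro add_pos_pos zero_less_power)
  ultimately show ?thesis
    unfolding joint_abs_def fst_conv snd_conv p_def
    by (simp only: sqrt_op_diagonal[OF bounded_squares])
qed

text \<open>Each \<open>ket k\<close> is an eigenvector of the joint modulus with eigenvalue
  \<open>p k > 0\<close>, so dividing by \<open>p k\<close> determines both components; all kernels
  involved are zero.\<close>

lemma joint_polar_part_wshift:
  "joint_polar_part (wshift f a, wshift g b)
    = (wshift f (\<lambda>k. a k / p k), wshift g (\<lambda>k. b k / p k))"
  unfolding joint_polar_part_def joint_abs_wshift
proof (rule the_equality)
  note q = bounded_range_normalized_weights
  note p = bounded_range_joint_modulus
  have ne: "p k \<noteq> 0" "a k \<noteq> 0" "b k \<noteq> 0" for k
    using p_pos[of k] pos[of k] by simp_all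
  show "bounded_op (fst (wshift f (\<lambda>k. a k / p k), wshift g (\<lambda>k. b k / p k))) \<and>
    bounded_op (snd (wshift f (\<lambda>k. a k / p k), wshift g (\<lambda>k. b k / p k))) \<and>
    fst (wshift f a, wshift g b)
      = fst (wshift f (\<lambda>k. a k / p k), wshift g (\<lambda>k. b k / p k)) \<circ> wshift id p \<and>
    snd (wshift f a, wshift g b)
      = snd (wshift f (\<lambda>k. a k / p k), wshift g (\<lambda>k. b k / p k)) \<circ> wshift id p \<and>
    kernel (fst (wshift f (\<lambda>k. a k / p k), wshift g (\<lambda>k. b k / p k))) \<inter>
      kernel (snd (wshift f (\<lambda>k. a k / p k), wshift g (\<lambda>k. b k / p k))) = kernel (wshift id p)"
    by (simp add: bounded_op_wshift fg q wshift_comp p kernel_wshift ne)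
  fix U
  assume U: "bounded_op (fst U) \<and> bounded_op (snd U) \<and>
    fst (wshift f a, wshift g b) = fst U \<circ> wshift id p \<and>
    snd (wshift f a, wshift g b) = snd U \<circ> wshift id p \<and>
    kernel (fst U) \<inter> kernel (snd U) = kernel (wshift id p)"
  have "fst U = wshift f (\<lambda>k. a k / p k)"
  proof (rule wshift_eqI[OF fg(1) q(1)])
    show "fst U (ket k) = (a k / p k) *\<^sub>R ket (f k)" for k
    proof -
      have "fst U (ket k) = inverse (p k) *\<^sub>R wshift f a (ket k)"
        by (rule diagonal_cancel_ket) (use U p ne in \<open>simp_all del: comp_apply\<close>)
      thus ?thesis by (simp add: wshift_ket fg ab divide_inverse mult.commute)
    qed
  qed (use U in simp)
  moreover have "snd U = wshift g (\<lambda>k. b k / p k)"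
  proof (rule wshift_eqI[OF fg(2) q(2)])
    show "snd U (ket k) = (b k / p k) *\<^sub>R ket (g k)" for k
    proof -
      have "snd U (ket k) = inverse (p k) *\<^sub>R wshift g b (ket k)"
        by (rule diagonal_cancel_ket) (use U p ne in \<open>simp_all del: comp_apply\<close>)
      thus ?thesis by (simp add: wshift_ket fg ab divide_inverse mult.commute)
    qed
  qed (use U in simp)
  ultimately show "U = (wshift f (\<lambda>k. a k / p k), wshift g (\<lambda>k. b k / p k))"
    by (simp add: prod_eq_iff)
qed

lemma spherical_aluthge_wshift:
  "spherical_aluthge (wshift f a, wshift g b)
    = (wshift f (\<lambda>k. sqrt (p (f k)) * (a k / p k) * sqrt (p k)),
       wshift g (\<lambda>k. sqrt (p (g k)) * (b k / p k) * sqrt (p k)))"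
  unfolding spherical_aluthge_def joint_abs_wshift joint_polar_part_wshift
    sqrt_op_diagonal[OF bounded_range_joint_modulus p_pos]
  unfolding fst_conv snd_conv
  by (simp only: diagonal_wshift_diagonal fg bounded_range_sqrt bounded_range_joint_modulus
      bounded_range_normalized_weights)

lemma bounded_range_spherical_weights:
  "bounded (range (\<lambda>k. sqrt (p (f k)) * (a k / p k) * sqrt (p k)))"
  "bounded (range (\<lambda>k. sqrt (p (g k)) * (b k / p k) * sqrt (p k)))"
  by (intro bounded_range_mult bounded_range_normalized_weights bounded_range_sqrt
      bounded_range_joint_modulus bounded_range_comp[OF bounded_range_joint_modulus, of f]
      bounded_range_comp[OF bounded_range_joint_modulus, of g])+

text \<open>At the intermediate index of either product the factors in \<open>p\<close> cancel. What
  remains is the product of the original weights times a factor depending only on \<open>k\<close>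
  and \<open>f (g k)\<close>, so commutation is inherited.\<close>

lemma spherical_aluthge_commuting:
  assumes comm: "f \<circ> g = g \<circ> f" and "\<And>k. b (f k) * a k = a (g k) * b k"
  shows "commuting_pair (spherical_aluthge (wshift f a, wshift g b))"
  unfolding spherical_aluthge_wshift
proof (subst commuting_pair_wshift[OF fg comm bounded_range_spherical_weights], intro allI)
  fix k
  have c: "f (g k) = g (f k)" using comm by (simp add: fun_eq_iff)
  have r: "sqrt (p j) * sqrt (p j) = p j" "p j \<noteq> 0" for j using p_pos[of j] by simp_all
  have "sqrt (p (f (g k))) * (a (g k) / p (g k)) * sqrt (p (g k)) *
      (sqrt (p (g k)) * (b k / p k) * sqrt (p k))
    = sqrt (p (f (g k))) * (a (g k) * b k) * sqrt (p k) / p k *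
      (sqrt (p (g k)) * sqrt (p (g k)) / p (g k))"
    by (simp only: divide_inverse mult_ac)
  also have "\<dots> = sqrt (p (g (f k))) * (b (f k) * a k) * sqrt (p k) / p k *
      (sqrt (p (f k)) * sqrt (p (f k)) / p (f k))"
    by (simp only: r c assms(2) divide_self not_False_eq_True)
  also have "\<dots> = sqrt (p (g (f k))) * (b (f k) / p (f k)) * sqrt (p (f k)) *
      (sqrt (p (f k)) * (a k / p k) * sqrt (p k))"
    by (simp only: divide_inverse mult_ac)
  finally show "sqrt (p (f (g k))) * (a (g k) / p (g k)) * sqrt (p (g k)) *
      (sqrt (p (g k)) * (b k / p k) * sqrt (p k))
    = sqrt (p (g (f k))) * (b (f k) / p (f k)) * sqrt (p (f k)) *
      (sqrt (p (f k)) * (a k / p k) * sqrt (p k))" .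
qed

end

text \<open>Here \<open>x\<close>, \<open>y\<close>, \<open>z\<close> and \<open>b\<close>,
  \<open>b1\<close>, \<open>b2\<close> are the two weights at three consecutive points in the first
  direction, and \<open>u\<close>, \<open>v\<close> are the first weights one step across from
  \<open>x\<close>, \<open>y\<close>. After squaring, the claim is
  \<open>x\<^sup>2 * Q\<^sup>2 \<le> y\<^sup>2 * (P * R)\<close>, obtained by inserting
  \<open>y\<^sup>2 * (x * z + b * b2)\<close> in between.\<close>

lemma spherical_weight_mono:
  fixes x y z b b1 b2 u v :: real
  assumes pos: "0 < x" "0 < b" "0 < b1" "0 < b2" "0 < u"
    and mono: "x \<le> y" "y \<le> z" "u \<le> v"
    and comm: "b1 * x = u * b" "b2 * y = v * b1"
  defines "P \<equiv> sqrt (x\<^sup>2 + b\<^sup>2)" and "Q \<equiv> sqrt (y\<^sup>2 + b1\<^sup>2)" and "R \<equiv> sqrt (z\<^sup>2 + b2\<^sup>2)"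
  shows "(sqrt Q * (x / P) * sqrt P)\<^sup>2 \<le> (sqrt R * (y / Q) * sqrt Q)\<^sup>2"
proof -
  have PQR: "P > 0" "Q > 0" "R > 0"
    using pos mono by (simp_all add: P_def Q_def R_def add_pos_pos)
  \<comment> \<open>The factor \<open>b * b1\<close> is chosen so that the commutation relations
    eliminate \<open>u\<close> and \<open>v\<close>, bounding the \<open>b1\<close> part of
    \<open>Q\<^sup>2\<close>.\<close>
  have "x * u * (b * b1) \<le> y * v * (b * b1)"
    using pos mono by (intro mult_right_mono mult_mono) auto
  moreover have "x * u * (b * b1) = x * b1 * (b1 * x)" "y * v * (b * b1) = y * b * (b2 * y)"
    unfolding comm by simp_all
  ultimately have "x\<^sup>2 * b1\<^sup>2 \<le> y\<^sup>2 * (b * b2)"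
    by (simp only: power2_eq_square mult_ac)
  moreover have "x\<^sup>2 * y\<^sup>2 \<le> y\<^sup>2 * (x * z)"
    using pos mono by (simp add: power2_eq_square)
  ultimately have "x\<^sup>2 * Q\<^sup>2 \<le> y\<^sup>2 * (x * z + b * b2)"
    by (simp add: Q_def distrib_left)
  also have "x * z + b * b2 \<le> P * R"
    unfolding P_def R_def real_sqrt_mult[symmetric]
  proof (rule real_le_rsqrt)
    \<comment> \<open>Lagrange's identity for the vectors \<open>(x, b)\<close> and
      \<open>(z, b2)\<close>.\<close>
    have "(x\<^sup>2 + b\<^sup>2) * (z\<^sup>2 + b2\<^sup>2) - (x * z + b * b2)\<^sup>2 = (x * b2 - b * z)\<^sup>2"
      by (simp add: power2_eq_square algebra_simps)
    thus "(x * z + b * b2)\<^sup>2 \<le> (x\<^sup>2 + b\<^sup>2) * (z\<^sup>2 + b2\<^sup>2)"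
      using zero_le_power2[of "x * b2 - b * z"] by linarith
  qed
  hence "y\<^sup>2 * (x * z + b * b2) \<le> y\<^sup>2 * (P * R)"
    by (intro mult_left_mono) auto
  finally have "Q * x\<^sup>2 / P \<le> R * y\<^sup>2 / Q"
    using PQR by (simp add: field_simps power2_eq_square)
  thus ?thesis
    using PQR by (simp add: power_mult_distrib power_divide) (simp add: power2_eq_square)
qed

text \<open>Stated for abstract \<open>a\<close>, \<open>b\<close>, \<open>f\<close>,
  \<open>g\<close> so that it serves both coordinates after exchanging roles. Monotonicity of
  \<open>a\<close> along \<open>f\<close> is used at \<open>k\<close>, \<open>f k\<close> and
  \<open>g k\<close>.\<close>

lemma hyponormal_spherical_weights:
  fixes a b :: "'a \<Rightarrow> real"
  assumes "\<And>k. a k > 0" "\<And>k. b k > 0"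
    and mono: "\<And>k. a k \<le> a (f k)"
    and comm: "\<And>k. b (f k) * a k = a (g k) * b k" and fg: "\<And>k. f (g k) = g (f k)"
  defines "p \<equiv> \<lambda>k. sqrt ((a k)\<^sup>2 + (b k)\<^sup>2)"
  shows "(sqrt (p (f k)) * (a k / p k) * sqrt (p k))\<^sup>2
    \<le> (sqrt (p (f (f k))) * (a (f k) / p (f k)) * sqrt (p (f k)))\<^sup>2"
  unfolding p_def
  by (rule spherical_weight_mono[where u = "a (g k)" and v = "a (g (f k))"])
    (use mono[of "g k"] in \<open>simp_all add: assms(1,2) mono comm fg\<close>)

section \<open>Both transforms of a commuting 2-variable weighted shift\<close>

theorem proposition2p1:
  fixes \<alpha> \<beta> :: "nat \<times> nat \<Rightarrow> real"
    and T1 T2 :: "(nat \<times> nat) ell2 \<Rightarrow> (nat \<times> nat) ell2"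
  assumes "commuting_weighted_shift \<alpha> \<beta> (T1, T2)"
  shows
    "(commuting_pair (toral_aluthge (T1, T2)) \<longleftrightarrow>
        (\<forall>k1 k2. \<alpha> (k1, k2 + 1) * \<alpha> (k1 + 1, k2 + 1) = \<alpha> (k1 + 1, k2) * \<alpha> (k1, k2 + 2))) \<and>
     (commuting_pair (toral_aluthge (T1, T2)) \<longleftrightarrow>
        (\<forall>k1 k2. \<beta> (k1 + 1, k2) * \<beta> (k1 + 1, k2 + 1) = \<beta> (k1, k2 + 1) * \<beta> (k1 + 2, k2))) \<and>
     commuting_pair (spherical_aluthge (T1, T2)) \<and>
     (hyponormal T1 \<and> hyponormal T2 \<longrightarrow>
        commuting_pair (spherical_aluthge (T1, T2)) \<and>
        hyponormal (fst (spherical_aluthge (T1, T2))) \<and>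
        hyponormal (snd (spherical_aluthge (T1, T2))))"
proof -
  define f g :: "nat \<times> nat \<Rightarrow> nat \<times> nat" where "f = (\<lambda>k. k + (1, 0))" and "g = (\<lambda>k. k + (0, 1))"
  have fg: "inj f" "inj g" "f \<circ> g = g \<circ> f" "\<And>k. f (g k) = g (f k)"
    by (auto simp: f_def g_def inj_def fun_eq_iff)
  have ab: "bounded (range \<alpha>)" "bounded (range \<beta>)"
    and pos: "\<And>k. \<alpha> k > 0" "\<And>k. \<beta> k > 0"
    and comm: "\<And>k. \<beta> (f k) * \<alpha> k = \<alpha> (g k) * \<beta> k"
    using assms by (auto simp: commuting_weighted_shift_def f_def g_def)
  have T: "T1 = wshift f \<alpha>" "T2 = wshift g \<beta>"
    using assms fg ab
    by (auto intro!: wshift_eqI simp: commuting_weighted_shift_def f_def g_def)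

  have toral: "commuting_pair (toral_aluthge (T1, T2)) \<longleftrightarrow>
      (\<forall>k. \<beta> (g (f k)) * \<alpha> (f k) = \<alpha> (f (g k)) * \<beta> (g k))"
  proof -
    have "commuting_pair (toral_aluthge (T1, T2)) \<longleftrightarrow>
        (\<forall>k. sqrt (\<alpha> (f (g k))) * sqrt (\<alpha> (g k)) * (sqrt (\<beta> (g k)) * sqrt (\<beta> k)) =
             sqrt (\<beta> (g (f k))) * sqrt (\<beta> (f k)) * (sqrt (\<alpha> (f k)) * sqrt (\<alpha> k)))"
      unfolding toral_aluthge_def T fst_conv snd_conv
        aluthge_wshift[OF fg(1) ab(1) pos(1)] aluthge_wshift[OF fg(2) ab(2) pos(2)]
      by (intro commuting_pair_wshift fg bounded_range_mult bounded_range_sqrt ab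
          bounded_range_comp[OF ab(1), of f] bounded_range_comp[OF ab(2), of g])
    also have "\<dots> \<longleftrightarrow> (\<forall>k. \<alpha> (f (g k)) * \<beta> (g k) * (\<alpha> (g k) * \<beta> k) =
        \<beta> (g (f k)) * \<alpha> (f k) * (\<beta> (f k) * \<alpha> k))"
      by (simp only: real_sqrt_mult[symmetric] real_sqrt_eq_iff mult_ac)
    \<comment> \<open>By \<open>comm\<close> the trailing factors on the two sides are the same
      positive number and cancel.\<close>
    also have "\<dots> \<longleftrightarrow> (\<forall>k. \<beta> (g (f k)) * \<alpha> (f k) = \<alpha> (f (g k)) * \<beta> (g k))"
      unfolding comm using pos by (auto simp: less_imp_neq[symmetric])
    finally show ?thesis .
  qed
  have "\<beta> (g (f k)) * \<alpha> (f k) = \<alpha> (f (g k)) * \<beta> (g k) \<longleftrightarrow>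
      \<alpha> (g k) * \<alpha> (f (g k)) = \<alpha> (f k) * \<alpha> (g (g k))" for k
  proof -
    \<comment> \<open>To eliminate \<beta>, multiply by \<open>\<alpha> (g k)\<close>: then
      \<open>comm\<close> at \<open>g k\<close> applies on the left and \<open>\<beta> (g k)\<close>
      cancels.\<close>
    have "\<beta> (g (f k)) * \<alpha> (f k) = \<alpha> (f (g k)) * \<beta> (g k) \<longleftrightarrow>
        (\<beta> (g (f k)) * \<alpha> (g k)) * \<alpha> (f k) = \<alpha> (f (g k)) * \<beta> (g k) * \<alpha> (g k)"
      using pos(1)[of "g k"] by (auto simp: mult_ac)
    also have "\<dots> \<longleftrightarrow> \<alpha> (g k) * \<alpha> (f (g k)) = \<alpha> (f k) * \<alpha> (g (g k))"
      using comm[of "g k"] pos(2)[of "g k"] by (auto simp: fg(4) mult_ac)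
    finally show ?thesis .
  qed
  with toral have toral_a: "commuting_pair (toral_aluthge (T1, T2)) \<longleftrightarrow>
      (\<forall>k. \<alpha> (g k) * \<alpha> (f (g k)) = \<alpha> (f k) * \<alpha> (g (g k)))" by simp
  have "\<beta> (g (f k)) * \<alpha> (f k) = \<alpha> (f (g k)) * \<beta> (g k) \<longleftrightarrow>
      \<beta> (f k) * \<beta> (f (g k)) = \<beta> (g k) * \<beta> (f (f k))" for k
  proof -
    \<comment> \<open>To eliminate \<alpha>, multiply by \<open>\<beta> (f k)\<close>: then
      \<open>comm\<close> at \<open>f k\<close> applies on the right and
      \<open>\<alpha> (f k)\<close> cancels.\<close>
    have "\<beta> (g (f k)) * \<alpha> (f k) = \<alpha> (f (g k)) * \<beta> (g k) \<longleftrightarrow>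
        \<beta> (g (f k)) * \<alpha> (f k) * \<beta> (f k) = (\<alpha> (g (f k)) * \<beta> (f k)) * \<beta> (g k)"
      using pos(2)[of "f k"] by (auto simp: mult_ac fg(4))
    also have "\<dots> \<longleftrightarrow> \<beta> (f k) * \<beta> (f (g k)) = \<beta> (g k) * \<beta> (f (f k))"
      unfolding comm[symmetric] using pos(1)[of "f k"] by (auto simp: fg(4) mult_ac)
    finally show ?thesis .
  qed
  with toral have toral_b: "commuting_pair (toral_aluthge (T1, T2)) \<longleftrightarrow>
      (\<forall>k. \<beta> (f k) * \<beta> (f (g k)) = \<beta> (g k) * \<beta> (f (f k)))" by simp

  have spherical: "commuting_pair (spherical_aluthge (T1, T2))"
    unfolding T by (rule spherical_aluthge_commuting[OF fg(1,2) ab pos fg(3) comm])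
  note sph = spherical_aluthge_wshift[OF fg(1,2) ab pos]
    and bdd = bounded_range_spherical_weights[OF fg(1,2) ab pos]
  have hypo1: "hyponormal (fst (spherical_aluthge (T1, T2)))" if "hyponormal T1"
  proof -
    have mono: "\<alpha> k \<le> \<alpha> (f k)" for k
      using that unfolding T(1) hyponormal_wshift[OF fg(1) ab(1)]
      by (blast intro: power2_le_imp_le less_imp_le[OF pos(1)])
    show ?thesis
      unfolding T sph fst_conv hyponormal_wshift[OF fg(1) bdd(1)]
      by (rule allI, rule hyponormal_spherical_weights[where a = \<alpha> and b = \<beta> and f = f and g = g,
            OF pos mono comm fg(4)])
  qed
  have hypo2: "hyponormal (snd (spherical_aluthge (T1, T2)))" if "hyponormal T2"
  proof -
    have mono: "\<beta> k \<le> \<beta> (g k)" for k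
      using that unfolding T(2) hyponormal_wshift[OF fg(2) ab(2)]
      by (blast intro: power2_le_imp_le less_imp_le[OF pos(2)])
    \<comment> \<open>With the roles exchanged, the inequality has the joint modulus with the
      \<beta> term first.\<close>
    have swap: "(\<alpha> k)\<^sup>2 + (\<beta> k)\<^sup>2 = (\<beta> k)\<^sup>2 + (\<alpha> k)\<^sup>2" for k
      by (rule add.commute)
    show ?thesis
      unfolding T sph snd_conv hyponormal_wshift[OF fg(2) bdd(2)]
      unfolding swap
      by (rule allI, rule hyponormal_spherical_weights[where a = \<beta> and b = \<alpha> and f = g and g = f,
            OF pos(2,1) mono comm[symmetric] fg(4)[symmetric]])
  qed
  \<comment> \<open>Unfolding 2 as a double successor identifies offsets by 2 with
    \<open>f (f k)\<close> and \<open>g (g k)\<close>.\<close>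
  show ?thesis
    using toral_a toral_b spherical hypo1 hypo2 by (simp add: f_def g_def numeral_2_eq_2)
qed

end
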